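(* Let $Q$ be a nonzero commutative unital ring, let $\mathbf w=(w_1,\ldots,w_n)$ be a nonempty vector of positive integers, and let $R_{\mathbf w}$ be the Rees ring of $\mathbf w$ over $Q$. Let $N:=\operatorname{lcm}(1,2,\ldots,\max(\mathbf w))$. Then the Veronese subring $R_{\mathbf w}^{(N)}$ is generated in degree $1$.
   Context: The Rees ring is the subring $R_{\mathbf w}:=Q[\{t^dx_i\mid i\in\{1,\ldots,n\},\ d\in\{0,\ldots,w_i\}\}]$ of the polynomial ring $Q[t,x_1,\ldots,x_n]$, graded by the degree in $t$ (so $x_1,\dots,x_n$ have degree $0$); equivalently it is the nonnegative-degree part of $Q[t^{-1},t^{w_1}x_1,\ldots,t^{w_n}x_n]$. Its degree-zero part is $Q[x_1,\ldots,x_n]$. For a $\mathbb Z_{\ge0}$-graded ring $S$ and an integer $r\ge1$, the $r$th Veronese subring is $S^{(r)}:=\bigoplus_{m\ge0}S_{rm}$, where $S_{rm}$ is the $m$th graded component of $S^{(r)}$. A graded ring $S$ is generated in degree $1$ if $S=S_0\oplus\bigoplus_{m\ge1}S_1^m$, where $S_1^m$ is the additive subgroup generated by $m$-fold products of elements of $S_1$. *)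

theory Defs
  imports
    "HOL.Hull"
    "HOL-Library.Poly_Mapping"
    "HOL-Computational_Algebra.Group_Closure"
begin

section \<open>Graded subrings of a commutative ring\<close>

text \<open>
  A graded ring is a subset \<open>S\<close> of an ambient commutative ring type together with its family
  of components \<open>G :: nat \<Rightarrow> 'r set\<close>; the additive subgroup generated by a set is the library's
  \<open>group_closure\<close>.
\<close>

definition is_subring :: "'r::comm_ring_1 set \<Rightarrow> bool"
  where "is_subring S \<longleftrightarrow> 1 \<in> S \<and> (\<forall>a\<in>S. \<forall>b\<in>S. a - b \<in> S \<and> a * b \<in> S)"

definition sum_of :: "(nat \<Rightarrow> 'r::comm_ring_1 set) \<Rightarrow> 'r set"
  where "sum_of A = {\<Sum>i\<in>I. f i | I f. finite I \<and> (\<forall>i\<in>I. f i \<in> A i)}"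

text \<open>The second conjunct expresses directness, for families of additive subgroups \<open>A i\<close>.\<close>

definition is_direct_sum :: "'r::comm_ring_1 set \<Rightarrow> (nat \<Rightarrow> 'r set) \<Rightarrow> bool"
  where "is_direct_sum S A \<longleftrightarrow>
    S = sum_of A \<and>
    (\<forall>I f. finite I \<longrightarrow> (\<forall>i\<in>I. f i \<in> A i) \<longrightarrow> (\<Sum>i\<in>I. f i) = 0 \<longrightarrow> (\<forall>i\<in>I. f i = 0))"

definition graded_ring :: "'r::comm_ring_1 set \<Rightarrow> (nat \<Rightarrow> 'r set) \<Rightarrow> bool"
  where "graded_ring S G \<longleftrightarrow>
    is_subring S \<and>
    (\<forall>d. group_closure (G d) = G d) \<and>
    is_direct_sum S G \<and>
    1 \<in> G 0 \<and>
    (\<forall>d e. \<forall>a\<in>G d. \<forall>b\<in>G e. a * b \<in> G (d + e))"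

text \<open>The Veronese subring and its grading: its \<open>m\<close>-th component is the \<open>(r * m)\<close>-th one of \<open>G\<close>.\<close>

definition veronese_component :: "nat \<Rightarrow> (nat \<Rightarrow> 'r::comm_ring_1 set) \<Rightarrow> nat \<Rightarrow> 'r set"
  where "veronese_component r G m = G (r * m)"

definition veronese :: "nat \<Rightarrow> (nat \<Rightarrow> 'r::comm_ring_1 set) \<Rightarrow> 'r set"
  where "veronese r G = sum_of (veronese_component r G)"

definition power_span :: "'r::comm_ring_1 set \<Rightarrow> nat \<Rightarrow> 'r set"
  where "power_span A m = group_closure {\<Prod>j<m. f j | f. \<forall>j<m. f j \<in> A}"

definition generated_in_degree_one :: "'r::comm_ring_1 set \<Rightarrow> (nat \<Rightarrow> 'r set) \<Rightarrow> bool"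
  where "generated_in_degree_one S G \<longleftrightarrow>
    is_direct_sum S (\<lambda>m. if m = 0 then G 0 else power_span (G 1) m)"

section \<open>The Rees ring\<close>

text \<open>
  Polynomials over \<open>'a\<close> are finitely supported functions on monomials, and a monomial
  \<open>nat \<Rightarrow>\<^sub>0 nat\<close> gives the exponent of each variable.  The variable with index \<open>0\<close> is \<open>t\<close> and, for
  \<open>1 \<le> i\<close>, the one with index \<open>i\<close> is \<open>x\<^sub>i\<close>.  The type has infinitely many variables, but those
  with an index above \<open>n\<close> do not occur in the elements of \<open>rees_ring n w\<close>, which is therefore a
  subring of the polynomial ring in \<open>t, x\<^sub>1, \<dots>, x\<^sub>n\<close>.
\<close>

type_synonym 'a mpoly = "(nat \<Rightarrow>\<^sub>0 nat) \<Rightarrow>\<^sub>0 'a"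

definition mconst :: "'a::comm_ring_1 \<Rightarrow> 'a mpoly"
  where "mconst c = Poly_Mapping.single 0 c"

definition mvar :: "nat \<Rightarrow> 'a::comm_ring_1 mpoly"
  where "mvar i = Poly_Mapping.single (Poly_Mapping.single i 1) 1"

definition rees_ring :: "nat \<Rightarrow> (nat \<Rightarrow> nat) \<Rightarrow> 'a::comm_ring_1 mpoly set"
  where "rees_ring n w =
    is_subring hull (range mconst \<union> {mvar 0 ^ d * mvar i | i d. i \<in> {1..n} \<and> d \<le> w i})"

text \<open>The elements of the Rees ring that are homogeneous of degree \<open>d\<close> in \<open>t\<close> (including \<open>0\<close>).\<close>

definition rees_component :: "nat \<Rightarrow> (nat \<Rightarrow> nat) \<Rightarrow> nat \<Rightarrow> 'a::comm_ring_1 mpoly set"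
  where "rees_component n w d =
    {p \<in> rees_ring n w. \<forall>m \<in> Poly_Mapping.keys p. Poly_Mapping.lookup m 0 = d}"

section \<open>Both rings are graded rings\<close>

lemma is_subring_zero: "is_subring S \<Longrightarrow> 0 \<in> S"
  unfolding is_subring_def by (metis diff_self)

lemma is_subring_add: "is_subring S \<Longrightarrow> a \<in> S \<Longrightarrow> b \<in> S \<Longrightarrow> a + b \<in> S"
  using is_subring_zero[of S] unfolding is_subring_def
  by (metis diff_0 diff_minus_eq_add)

lemma is_subring_mult: "is_subring S \<Longrightarrow> a \<in> S \<Longrightarrow> b \<in> S \<Longrightarrow> a * b \<in> S"
  unfolding is_subring_def by blast

lemma is_subring_sum:
  assumes "is_subring S" "\<And>i. i \<in> I \<Longrightarrow> f i \<in> S"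
  shows "(\<Sum>i\<in>I. f i) \<in> S"
  using assms(2)
  by (induction I rule: infinite_finite_induct)
    (auto simp: is_subring_zero[OF assms(1)] is_subring_add[OF assms(1)])

lemma is_subring_hull: "is_subring (is_subring hull X)"
  by (rule hull_in) (auto simp: is_subring_def)

lemma is_subring_rees_ring: "is_subring (rees_ring n w)"
  unfolding rees_ring_def by (rule is_subring_hull)

lemma group_closure_eqI:
  assumes "0 \<in> A" "\<And>a b. a \<in> A \<Longrightarrow> b \<in> A \<Longrightarrow> a - b \<in> A"
  shows "group_closure A = A"
proof
  show "group_closure A \<subseteq> A"
  proof
    fix x assume "x \<in> group_closure A"
    then show "x \<in> A" by induction (use assms in auto)
  qed
  show "A \<subseteq> group_closure A" by (auto intro: group_closure.base)
qed

lemma mpoly_eq_sum_monomials: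
  "(p :: 'a::comm_ring_1 mpoly) =
    (\<Sum>m\<in>Poly_Mapping.keys p. Poly_Mapping.single m (Poly_Mapping.lookup p m))"
  by (rule poly_mapping_eqI) (auto simp: lookup_sum lookup_single when_def in_keys_iff)

lemma mvar_power:
  "mvar i ^ d = (Poly_Mapping.single (Poly_Mapping.single i d) 1 :: 'a::comm_ring_1 mpoly)"
  by (induction d) (auto simp: mvar_def mult_single simp flip: single_add)

lemma mpoly_keys_diff:
  "Poly_Mapping.keys (p - q :: 'a::comm_ring_1 mpoly)
    \<subseteq> Poly_Mapping.keys p \<union> Poly_Mapping.keys q"
  by (auto simp: in_keys_iff lookup_minus)

lemma rees_ring_monomial:
  fixes p :: "'a::comm_ring_1 mpoly"
  assumes "p \<in> rees_ring n w" "m \<in> Poly_Mapping.keys p"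
  shows "Poly_Mapping.single m (1::'a) \<in> rees_ring n w"
proof -
  let ?R = "rees_ring n w :: 'a mpoly set"
  let ?g = "range mconst \<union> {mvar 0 ^ d * mvar i | i d. i \<in> {1..n} \<and> d \<le> w i} :: 'a mpoly set"
  let ?T = "{p :: 'a mpoly. \<forall>m\<in>Poly_Mapping.keys p. Poly_Mapping.single m (1::'a) \<in> ?R}"
  note R = is_subring_rees_ring[of n w, where 'a = 'a]
  have one: "1 \<in> ?R" using R by (auto simp: is_subring_def)
  have gR: "?g \<subseteq> ?R" unfolding rees_ring_def by (rule hull_subset)
  have "?R \<subseteq> ?T"
    unfolding rees_ring_def[of n w, where 'a = 'a]
  proof (rule hull_minimal, fold rees_ring_def[of n w, where 'a = 'a])
    show "?g \<subseteq> ?T"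
    proof
      fix q assume q: "q \<in> ?g"
      then consider c where "q = mconst c"
        | i d where "q = mvar 0 ^ d * mvar i" by blast
      then show "q \<in> ?T"
      proof cases
        case 1
        then show ?thesis using one by (auto simp: mconst_def)
      next
        case 2
        define k where "k = Poly_Mapping.single (0::nat) d + Poly_Mapping.single i (1::nat)"
        have qs: "q = Poly_Mapping.single k 1"
          unfolding 2 mvar_power by (simp add: k_def mvar_def mult_single)
        show ?thesis using q gR unfolding qs by auto
      qed
    qed
    show "is_subring ?T"
      unfolding is_subring_def
    proof (intro conjI ballI)
      show "1 \<in> ?T" using one by simp
      fix a b assume ab: "a \<in> ?T" "b \<in> ?T"
      show "a - b \<in> ?T" using ab mpoly_keys_diff[of a b] by blast
      show "a * b \<in> ?T"
      proof (rule CollectI, rule ballI)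
        fix m assume "m \<in> Poly_Mapping.keys (a * b)"
        then obtain k l where kl: "m = k + l" "k \<in> Poly_Mapping.keys a" "l \<in> Poly_Mapping.keys b"
          using keys_mult[of a b] by blast
        have "Poly_Mapping.single m (1::'a) = Poly_Mapping.single k 1 * Poly_Mapping.single l 1"
          by (simp add: kl mult_single)
        then show "Poly_Mapping.single m (1::'a) \<in> ?R"
          using ab kl is_subring_mult[OF R] by auto
      qed
    qed
  qed
  then show ?thesis using assms by blast
qed

lemma rees_ring_term:
  fixes p :: "'a::comm_ring_1 mpoly"
  assumes "p \<in> rees_ring n w" "m \<in> Poly_Mapping.keys p"
  shows "Poly_Mapping.single m (c::'a) \<in> rees_ring n w"
proof -
  have "mconst c \<in> rees_ring n w"
    unfolding rees_ring_def by (rule hull_inc) auto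
  from is_subring_mult[OF is_subring_rees_ring this rees_ring_monomial[OF assms]]
  show ?thesis by (simp add: mconst_def mult_single)
qed

theorem graded_ring_rees:
  "graded_ring (rees_ring n w :: 'a::comm_ring_1 mpoly set) (rees_component n w)"
proof -
  let ?R = "rees_ring n w :: 'a mpoly set" and ?G = "rees_component n w :: nat \<Rightarrow> 'a mpoly set"
  note R = is_subring_rees_ring[of n w, where 'a = 'a]
  have "group_closure (?G d) = ?G d" for d
  proof (rule group_closure_eqI)
    show "0 \<in> ?G d" using is_subring_zero[OF R] by (simp add: rees_component_def)
    fix a b assume "a \<in> ?G d" "b \<in> ?G d"
    then show "a - b \<in> ?G d"
      using R mpoly_keys_diff[of a b] unfolding rees_component_def is_subring_def by blast
  qed
  moreover have "?R = sum_of ?G"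
  proof (rule subset_antisym)
    show "sum_of ?G \<subseteq> ?R"
      unfolding sum_of_def rees_component_def by (auto intro!: is_subring_sum[OF R])
    show "?R \<subseteq> sum_of ?G"
    proof
      fix p assume p: "p \<in> ?R"
      let ?K = "Poly_Mapping.keys p"
      let ?dg = "\<lambda>m::nat \<Rightarrow>\<^sub>0 nat. Poly_Mapping.lookup m 0"
      define f where "f d = (\<Sum>m\<in>{m\<in>?K. ?dg m = d}. Poly_Mapping.single m (Poly_Mapping.lookup p m))" for d
      have "p = (\<Sum>d\<in>?dg ` ?K. f d)"
        unfolding f_def
        by (subst mpoly_eq_sum_monomials, rule sum.image_gen) simp
      moreover have "f d \<in> ?G d" for d
      proof -
        have "f d \<in> ?R"
          unfolding f_def using rees_ring_term[OF p] by (intro is_subring_sum[OF R]) auto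
        moreover have "Poly_Mapping.keys (f d) \<subseteq> {m\<in>?K. ?dg m = d}"
          unfolding f_def
          by (auto simp: in_keys_iff lookup_sum lookup_single when_def
              elim!: sum.not_neutral_contains_not_neutral split: if_splits)
        ultimately show ?thesis unfolding rees_component_def by auto
      qed
      ultimately show "p \<in> sum_of ?G"
        unfolding sum_of_def by (intro CollectI exI[of _ "?dg ` ?K"] exI[of _ f]) auto
    qed
  qed
  moreover have "\<forall>i\<in>I. f i = 0"
    if I: "finite I" and f: "\<forall>i\<in>I. f i \<in> ?G i" and s: "(\<Sum>i\<in>I. f i) = 0" for I f
  proof (intro ballI poly_mapping_eqI)
    fix i m assume i: "i \<in> I"
    show "Poly_Mapping.lookup (f i) m = Poly_Mapping.lookup 0 m"
    proof (rule ccontr)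
      assume "\<not> ?thesis"
      then have nz: "m \<in> Poly_Mapping.keys (f i)" by (simp add: in_keys_iff)
      have "Poly_Mapping.lookup (f j) m = 0" if "j \<in> I" "j \<noteq> i" for j
      proof (rule ccontr)
        assume "\<not> ?thesis"
        then have "m \<in> Poly_Mapping.keys (f j)" by (simp add: in_keys_iff)
        then have "Poly_Mapping.lookup m 0 = j" "Poly_Mapping.lookup m 0 = i"
          using that nz i f unfolding rees_component_def by blast+
        then show False using that by simp
      qed
      then have "(\<Sum>j\<in>I. Poly_Mapping.lookup (f j) m) = Poly_Mapping.lookup (f i) m"
        using I i by (subst sum.remove[of I i]) auto
      moreover have "(\<Sum>j\<in>I. Poly_Mapping.lookup (f j) m) = 0"
        using s by (simp flip: lookup_sum)
      ultimately show False using nz by (simp add: in_keys_iff)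
    qed
  qed
  moreover have "a * b \<in> ?G (d + e)" if "a \<in> ?G d" "b \<in> ?G e" for a b d e
    using that keys_mult[of a b] is_subring_mult[OF R]
    unfolding rees_component_def by (fastforce simp: lookup_add)
  moreover have "1 \<in> ?G 0"
    using R by (simp add: rees_component_def is_subring_def)
  ultimately show ?thesis
    unfolding graded_ring_def is_direct_sum_def using R by (intro conjI allI ballI impI) simp_all
qed

theorem graded_ring_veronese:
  fixes S :: "'r::comm_ring_1 set"
  assumes S: "graded_ring S G" and r: "r \<ge> 1"
  shows "graded_ring (veronese r G) (veronese_component r G)"
proof -
  let ?H = "veronese_component r G"
  have gc: "group_closure (?H m) = ?H m" for m
    using S by (simp add: graded_ring_def veronese_component_def)
  have dir: "\<forall>i\<in>I. f i = 0" if "finite I" "\<forall>i\<in>I. f i \<in> ?H i" "(\<Sum>i\<in>I. f i) = 0" for I f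
  proof -
    have inj: "inj_on ((*) r) I" using r by (auto simp: inj_on_def)
    have "finite ((*) r ` I)" "\<forall>i\<in>(*) r ` I. f (i div r) \<in> G i"
      "(\<Sum>i\<in>(*) r ` I. f (i div r)) = 0"
      using that r by (auto simp: veronese_component_def sum.reindex[OF inj])
    then have "\<forall>i\<in>(*) r ` I. f (i div r) = 0"
      using S unfolding graded_ring_def is_direct_sum_def
      by (elim conjE allE[of _ "(*) r ` I"] allE[of _ "\<lambda>i. f (i div r)"]) blast
    then show ?thesis using r by auto
  qed
  have pr: "a * b \<in> ?H (d + e)" if "a \<in> ?H d" "b \<in> ?H e" for a b d e
    using S that by (auto simp: graded_ring_def veronese_component_def distrib_left)
  have zero: "0 \<in> ?H m" for m by (subst gc[symmetric]) simp
  have add: "a + b \<in> ?H m" if "a \<in> ?H m" "b \<in> ?H m" for a b m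
    using that group_closure_add[of a "?H m" b] by (simp add: gc)
  have neg: "- a \<in> ?H m" if "a \<in> ?H m" for a m
    using that group_closure_minus_iff[of a "?H m"] by (simp add: gc)
  have VI: "x \<in> veronese r G" if "x \<in> ?H m" for x m
    unfolding veronese_def sum_of_def
    using that by (intro CollectI exI[of _ "{m}"] exI[of _ "\<lambda>_. x"]) auto
  have Vadd: "x + y \<in> veronese r G" if xy: "x \<in> veronese r G" "y \<in> veronese r G" for x y
  proof -
    obtain I f where I: "finite I" "\<forall>i\<in>I. f i \<in> ?H i" "x = (\<Sum>i\<in>I. f i)"
      using xy(1) by (auto simp: veronese_def sum_of_def)
    obtain J g where J: "finite J" "\<forall>i\<in>J. g i \<in> ?H i" "y = (\<Sum>i\<in>J. g i)"
      using xy(2) by (auto simp: veronese_def sum_of_def)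
    let ?f = "\<lambda>i. if i \<in> I then f i else 0" and ?g = "\<lambda>i. if i \<in> J then g i else 0"
    have "x = (\<Sum>i\<in>I \<union> J. ?f i)" unfolding I(3) using I(1) J(1)
      by (intro sum.mono_neutral_cong_left) auto
    moreover have "y = (\<Sum>i\<in>I \<union> J. ?g i)" unfolding J(3) using I(1) J(1)
      by (intro sum.mono_neutral_cong_left) auto
    ultimately have "x + y = (\<Sum>i\<in>I \<union> J. ?f i + ?g i)" by (simp add: sum.distrib)
    moreover have "?f i + ?g i \<in> ?H i" for i using I(2) J(2) zero add by auto
    ultimately show ?thesis
      unfolding veronese_def sum_of_def using I(1) J(1)
      by (intro CollectI exI[of _ "I \<union> J"] exI[of _ "\<lambda>i. ?f i + ?g i"]) auto
  qed
  have Vsum: "(\<Sum>i\<in>I. h i) \<in> veronese r G" if "\<And>i. i \<in> I \<Longrightarrow> h i \<in> veronese r G" for I :: "nat set" and h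
    using that by (induction I rule: infinite_finite_induct) (auto intro: Vadd VI[OF zero[of 0]])
  have Vneg: "- y \<in> veronese r G" if "y \<in> veronese r G" for y
    using that unfolding veronese_def sum_of_def
    by (force simp: sum_negf[symmetric] intro: neg)
  have Vmult: "x * y \<in> veronese r G" if xy: "x \<in> veronese r G" "y \<in> veronese r G" for x y
  proof -
    obtain I f where I: "\<forall>i\<in>I. f i \<in> ?H i" "x = (\<Sum>i\<in>I. f i)"
      using xy(1) by (auto simp: veronese_def sum_of_def)
    obtain J g where J: "\<forall>i\<in>J. g i \<in> ?H i" "y = (\<Sum>i\<in>J. g i)"
      using xy(2) by (auto simp: veronese_def sum_of_def)
    show ?thesis
      unfolding I(2) J(2) sum_product using I(1) J(1) by (intro Vsum VI[OF pr]) auto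
  qed
  have one: "1 \<in> G 0"
    using S by (simp add: graded_ring_def)
  have "1 \<in> veronese r G"
    by (rule VI[of _ 0]) (use one in \<open>simp add: veronese_component_def\<close>)
  moreover have "a - b \<in> veronese r G" if "a \<in> veronese r G" "b \<in> veronese r G" for a b
    using Vadd[OF that(1) Vneg[OF that(2)]] by simp
  ultimately have sub: "is_subring (veronese r G)"
    unfolding is_subring_def using Vmult by simp
  have "1 \<in> ?H 0" using one by (simp add: veronese_component_def)
  moreover have "is_direct_sum (veronese r G) ?H"
    unfolding is_direct_sum_def veronese_def using dir by blast
  ultimately show ?thesis
    unfolding graded_ring_def using sub gc pr by blast
qed

end

(*
  The Rees ring is spanned by the monomials t^a x^k with a <= w_1 k_1 + ... + w_n k_n, so one has to
  split such a monomial with a = N m into m of the same kind with a = N.  This reduces to splitting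
  off, from a multiset of integers in {1..M} with sum at least 2 N, a part with sum exactly
  N = lcm(1,...,M).  Since M (M - 1) (M - 2) divides 2 N, some value v occurs at least M - 1 times
  (otherwise the sum would be at most (M - 2) M (M + 1) / 2 < 2 N).  Any v of the other elements
  contain a nonempty part with sum divisible by v, so they can be collected, with sum a multiple of
  v, until either less than v M is missing to N or fewer than v of them remain; in both cases
  copies of v fill the gap exactly.
*)
theory Submission
  imports Defs "HOL-Library.Multiset"
begin

section \<open>Submultisets whose sum is divisible by a given number\<close>

text \<open>Pigeonhole on prefix sums: after listing \<open>A\<close>, two of the
  \<open>v + 1\<close> prefix sums of lengths 0 to \<open>v\<close> agree modulo \<open>v\<close>,
  and the segment between them is the required part.\<close>

lemma submultiset_sum_dvd:
  fixes A :: "nat multiset"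
  assumes "v \<ge> 1" "v \<le> size A"
  obtains B where "B \<subseteq># A" "B \<noteq> {#}" "size B \<le> v" "v dvd sum_mset B"
proof -
  obtain xs where xs: "mset xs = A" using ex_mset by blast
  then have len: "v \<le> length xs" using assms by auto
  let ?f = "\<lambda>i. sum_list (take i xs) mod v"
  have "?f ` {..v} \<subseteq> {..<v}" using assms by auto
  then have "card (?f ` {..v}) \<le> v" using card_mono[of "{..<v}"] by fastforce
  then have "\<not> inj_on ?f {..v}"
    by (intro pigeonhole) simp
  then obtain i j where ij: "i < j" "j \<le> v" "?f i = ?f j"
    unfolding inj_on_def by (metis atMost_iff linorder_neqE_nat)
  let ?ys = "drop i (take j xs)"
  have take_split: "take j xs = take i xs @ ?ys"
    by (metis append_take_drop_id ij(1) less_imp_le min.absorb1 take_take)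
  have "sum_list (take j xs) = sum_list (take i xs) + sum_list ?ys"
    by (subst take_split) simp
  then have dvd: "v dvd sum_list ?ys"
    using ij(3) by (metis add_diff_cancel_left' le_add1 mod_eq_dvd_iff_nat)
  have "xs = take i xs @ ?ys @ drop j xs"
    by (metis append.assoc append_take_drop_id take_split)
  then have "mset xs = mset ?ys + (mset (take i xs) + mset (drop j xs))"
    by (metis mset_append union_assoc union_commute)
  then have "mset ?ys \<subseteq># A"
    using xs by simp
  moreover have "length ?ys = j - i" using ij len by simp
  ultimately show thesis
    using ij dvd by (intro that[of "mset ?ys"]) (auto simp: sum_mset_sum_list)
qed

lemma sum_mset_le_size_mult:
  fixes A :: "nat multiset"
  assumes "\<And>x. x \<in># A \<Longrightarrow> x \<le> M"
  shows "sum_mset A \<le> size A * M"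
  using sum_mset_mono[of A "\<lambda>x. x" "\<lambda>_. M"] assms by simp

text \<open>An extremal choice replaces repeated collecting: \<open>B\<close> has maximal size among
  the submultisets with sum divisible by \<open>v\<close> and at most \<open>T\<close>. If at least
  \<open>v\<close> elements remain, the previous lemma finds a further part \<open>C\<close> among
  them. It has at most \<open>v\<close> elements and hence sum at most \<open>v * M\<close>, and by
  maximality adding it must exceed \<open>T\<close>.\<close>

lemma submultiset_sum_dvd_le:
  fixes A :: "nat multiset"
  assumes v: "v \<ge> 1" and le: "\<And>x. x \<in># A \<Longrightarrow> x \<le> M"
  obtains B where "B \<subseteq># A" "v dvd sum_mset B" "sum_mset B \<le> T"
    "T < sum_mset B + v * M \<or> size (A - B) < v"
proof -
  let ?P = "\<lambda>B. B \<subseteq># A \<and> v dvd sum_mset B \<and> sum_mset B \<le> T"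
  have "?P {#}" by simp
  moreover have "\<forall>B. ?P B \<longrightarrow> size B < Suc (size A)" by (simp add: less_Suc_eq_le size_mset_mono)
  ultimately have "\<exists>B. ?P B \<and> (\<forall>C. ?P C \<longrightarrow> size C \<le> size B)"
    by (rule ex_has_greatest_nat)
  then obtain B where B: "?P B" and max: "\<And>C. ?P C \<Longrightarrow> size C \<le> size B"
    by (elim exE conjE) simp
  have "T < sum_mset B + v * M" if large: "v \<le> size (A - B)"
  proof -
    obtain C where C: "C \<subseteq># A - B" "C \<noteq> {#}" "size C \<le> v" "v dvd sum_mset C"
      using submultiset_sum_dvd[OF v large] .
    have "B + C \<subseteq># A"
      using B subset_mset.add_left_mono[OF C(1), of B] by (simp only: subset_mset.add_diff_inverse)
    moreover have "size (B + C) > size B"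
      using C(2) by (simp add: nonempty_has_size)
    moreover have "v dvd sum_mset (B + C)" using B C(4) by simp
    ultimately have "T < sum_mset B + sum_mset C"
      using max[of "B + C"] by (metis not_le sum_mset.union)
    moreover have "sum_mset C \<le> size C * M"
      by (intro sum_mset_le_size_mult le in_diffD[OF mset_subset_eqD[OF C(1)]])
    moreover have "size C * M \<le> v * M" using C(3) by simp
    ultimately show ?thesis by linarith
  qed
  then have "T < sum_mset B + v * M \<or> size (A - B) < v" by linarith
  with B show thesis by (intro that[of B]) auto
qed

section \<open>Lower bounds for the least common multiple of 1, ..., M\<close>

text \<open>Consecutive numbers are coprime, so their product divides the lcm. For \<open>M\<close>
  at most 1 the left side is 0.\<close>

lemma mult_pred_le_Lcm: "M * (M - 1) \<le> Lcm {1..M::nat}"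
proof (cases "M \<ge> 2")
  case True
  have "M dvd Lcm {1..M}" "(M - 1) dvd Lcm {1..M}" using True by (auto intro!: dvd_Lcm)
  moreover have "coprime M (M - 1)" using True coprime_diff_one_right_nat[of M] by simp
  ultimately have "M * (M - 1) dvd Lcm {1..M}" by (simp add: divides_mult)
  then show ?thesis by (rule dvd_imp_le) (auto simp: Lcm_0_iff intro!: Nat.gr0I)
next
  case False
  then have "M = 0 \<or> M = 1" by auto
  then show ?thesis by auto
qed

text \<open>The left side is twice the sum of 1, ..., \<open>M\<close> taken \<open>M - 2\<close>
  times each; this excludes that every value is rare. For \<open>M = k + 2\<close> with
  \<open>k\<close> at least 2, the gcd of \<open>(k + 1) * (k + 2)\<close> and \<open>k\<close>
  divides 2, so the product of all three is at most twice the lcm. The estimate then follows from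
  \<open>k + 3 < 2 * (k + 1)\<close>, which needs \<open>k > 1\<close>; hence the separate small
  cases.\<close>

lemma cubic_less_Lcm:
  assumes "M \<ge> 2"
  shows "(M - 2) * (M * (M + 1)) < 4 * Lcm {1..M::nat}"
proof -
  let ?N = "Lcm {1..M}"
  have pos: "?N > 0" by (auto simp: Lcm_0_iff intro!: Nat.gr0I)
  consider "M = 2" | "M = 3" | "M \<ge> 4" using assms by linarith
  then show ?thesis
  proof cases
    case 1
    then show ?thesis using pos by simp
  next
    case 2
    then show ?thesis using mult_pred_le_Lcm[of M] by simp
  next
    case 3
    then have "M = (M - 2) + 2" "M - 2 \<ge> 2" by auto
    then obtain k where k: "M = k + 2" "k \<ge> 2" by blast
    have dv: "k dvd ?N" "(k + 1) dvd ?N" "(k + 2) dvd ?N"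
      using k by (auto intro!: dvd_Lcm)
    have "coprime (k + 1) (k + 2)" using coprime_Suc_right_nat[of "k + 1"] by simp
    then have d1: "(k + 1) * (k + 2) dvd ?N" using dv by (intro divides_mult)
    have g: "gcd ((k + 1) * (k + 2)) k dvd 2"
    proof -
      have "(k + 1) * (k + 2) = 2 + k * (k + 3)" by (simp add: algebra_simps)
      then have "gcd ((k + 1) * (k + 2)) k dvd 2 + k * (k + 3)" by (metis gcd_dvd1)
      moreover have "gcd ((k + 1) * (k + 2)) k dvd k * (k + 3)" by (rule dvd_mult2[OF gcd_dvd2])
      ultimately show ?thesis using dvd_add_left_iff by blast
    qed
    have "lcm ((k + 1) * (k + 2)) k dvd ?N" using d1 dv by simp
    then have "lcm ((k + 1) * (k + 2)) k \<le> ?N" using pos by (rule dvd_imp_le)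
    moreover have "gcd ((k + 1) * (k + 2)) k \<le> 2" using g by (rule dvd_imp_le) simp
    ultimately have "gcd ((k + 1) * (k + 2)) k * lcm ((k + 1) * (k + 2)) k \<le> 2 * ?N"
      by (intro mult_le_mono)
    then have "(k + 1) * (k + 2) * k \<le> 2 * ?N" by (simp only: flip: prod_gcd_lcm_nat)
    moreover have "k * ((k + 2) * (k + 3)) < 2 * ((k + 1) * (k + 2) * k)"
    proof -
      have "k * (k + 2) * (k + 3) < k * (k + 2) * (2 * (k + 1))"
        using k by (intro mult_strict_left_mono) auto
      then show ?thesis by (simp add: algebra_simps)
    qed
    moreover have "(M - 2) * (M * (M + 1)) = k * ((k + 2) * (k + 3))"
      by (simp add: k algebra_simps)
    ultimately show ?thesis by linarith
  qed
qed

section \<open>Splitting off a part whose sum is exactly the lcm\<close>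

lemma sum_mset_image_eq_sum:
  fixes f :: "'b \<Rightarrow> nat"
  assumes "finite I" "set_mset B \<subseteq> I"
  shows "sum_mset (image_mset f B) = (\<Sum>i\<in>I. f i * count B i)"
  using assms(2)
proof (induction B)
  case (add x B)
  have "(\<Sum>i\<in>I. f i * count (add_mset x B) i) = (\<Sum>i\<in>I. f i * count B i + (if i = x then f i else 0))"
    by (intro sum.cong) auto
  also have "\<dots> = (\<Sum>i\<in>I. f i * count B i) + f x"
    using add.prems assms(1) by (simp add: sum.distrib)
  finally show ?case using add by simp
qed simp

text \<open>The bound \<open>2 * N\<close> enters twice: it forces some value \<open>v\<close> to be
  frequent, and it guarantees enough copies of \<open>v\<close> when the greedy collection stops for
  lack of other elements.\<close>

lemma submultiset_sum_eq_Lcm: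
  fixes A :: "nat multiset" and M :: nat
  defines "N \<equiv> Lcm {1..M}"
  assumes A: "\<And>x. x \<in># A \<Longrightarrow> x \<in> {1..M}" and total: "2 * N \<le> sum_mset A"
  obtains B where "B \<subseteq># A" "sum_mset B = N"
proof -
  have pos: "N > 0" unfolding N_def by (auto simp: Lcm_0_iff intro!: Nat.gr0I)
  have "\<exists>v. v \<in># A \<and> M - 1 \<le> count A v"
  proof (rule ccontr)
    assume neg: "\<not> ?thesis"
    obtain x where x: "x \<in># A" using total pos by (cases A) auto
    \<comment> \<open>For \<open>M\<close> at most 1 the truncated \<open>M - 1\<close> is 0, so
      that any element \<open>x\<close> would already satisfy the claim.\<close>
    then have M: "M \<ge> 2" using neg A[OF x] by (cases "M \<ge> 2") auto
    have "count A v \<le> M - 2" for v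
    proof (cases "v \<in># A")
      case True
      then have "count A v < M - 1" using neg by (meson not_le)
      then show ?thesis by linarith
    qed (simp add: not_in_iff)
    then have "sum_mset A \<le> (\<Sum>i\<in>{1..M}. i * (M - 2))"
      using sum_mset_image_eq_sum[of "{1..M}" A id] A by (auto simp: subset_iff intro!: sum_mono)
    also have "\<dots> = (M - 2) * \<Sum>{1..M}" by (simp add: sum_distrib_left mult.commute)
    finally have "2 * sum_mset A \<le> (M - 2) * (2 * \<Sum>{1..M})" by simp
    also have "2 * \<Sum>{1..M} = M * (M + 1)"
      using double_gauss_sum_from_Suc_0[of M, where 'a = nat] by simp
    also have "(M - 2) * (M * (M + 1)) < 4 * N" unfolding N_def by (rule cubic_less_Lcm[OF M])
    finally show False using total by linarith
  qed
  then obtain v where v: "v \<in># A" "M - 1 \<le> count A v" by blast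
  then have v1: "1 \<le> v" "v \<le> M" using A by auto
  have vN: "v dvd N" unfolding N_def using v1 by (intro dvd_Lcm) auto
  define c where "c = count A v"
  \<comment> \<open>Collecting only from the elements different from \<open>v\<close> keeps all
    \<open>c\<close> copies of \<open>v\<close> available for the gap.\<close>
  define A' where "A' = filter_mset (\<lambda>x. x \<noteq> v) A"
  have split: "A = A' + replicate_mset c v"
    unfolding A'_def c_def by (metis filter_eq_replicate_mset multiset_partition union_commute)
  obtain B where B: "B \<subseteq># A'" "v dvd sum_mset B" "sum_mset B \<le> N"
    "N < sum_mset B + v * M \<or> size (A' - B) < v"
    using submultiset_sum_dvd_le[of v A' M N] A v1(1) by (auto simp: A'_def)
  \<comment> \<open>The gap is a multiple of \<open>v\<close> because \<open>v\<close> divides both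
    \<open>N\<close> and the sum of \<open>B\<close>; \<open>q\<close> is the number of copies of
    \<open>v\<close> that fill it.\<close>
  obtain q where q: "N - sum_mset B = v * q"
    using B(2) vN by (meson dvdE dvd_diff_nat)
  have "q \<le> c" using B(4)
  proof
    assume "N < sum_mset B + v * M"
    then have "v * q < v * M" using q B(3) by linarith
    then have "q < M" by simp
    then show ?thesis using v(2) by (simp add: c_def)
  next
    assume "size (A' - B) < v"
    then have s: "size (A' - B) \<le> M - 1" using v1 by linarith
    have "sum_mset (A' - B) \<le> size (A' - B) * M"
      using A by (intro sum_mset_le_size_mult) (auto simp: A'_def dest!: in_diffD)
    also have "\<dots> \<le> (M - 1) * M" using s by simp
    also have "\<dots> \<le> N" using mult_pred_le_Lcm[of M] by (simp add: N_def mult.commute)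
    finally have "sum_mset (A' - B) \<le> N" .
    \<comment> \<open>The leftover elements account for at most \<open>N\<close> of a total of at
      least \<open>2 * N\<close>, so \<open>B\<close> and the \<open>c\<close> copies of
      \<open>v\<close> together reach \<open>N\<close>.\<close>
    moreover have "sum_mset A = sum_mset B + sum_mset (A' - B) + c * v"
      unfolding split sum_mset.union[symmetric] subset_mset.add_diff_inverse[OF B(1)] by simp
    ultimately have "v * q \<le> v * c"
      unfolding q[symmetric] mult.commute[of v c] using total by linarith
    then show ?thesis using v1 by simp
  qed
  have "B + replicate_mset q v \<subseteq># A" unfolding split
    using B(1) \<open>q \<le> c\<close> by (intro subset_mset.add_mono) (auto simp: subseteq_mset_def)
  moreover have "sum_mset (B + replicate_mset q v) = N"
    using q B(3) by (simp add: mult.commute)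
  ultimately show thesis by (rule that)
qed

text \<open>Passes from integers to indices, since several indices may share one weight. With index
  \<open>i\<close> taken \<open>k i\<close> times, the chosen submultiset of weights lifts along
  \<open>image_mset w\<close> to a submultiset of indices, whose multiplicities are
  \<open>l\<close>.\<close>

lemma weighted_subset_sum_eq_Lcm:
  fixes w k :: "'b \<Rightarrow> nat"
  assumes I: "finite I" and w: "\<And>i. i \<in> I \<Longrightarrow> w i \<in> {1..M}"
    and total: "2 * Lcm {1..M} \<le> (\<Sum>i\<in>I. w i * k i)"
  obtains l where "\<And>i. l i \<le> k i" "(\<Sum>i\<in>I. w i * l i) = Lcm {1..M}"
proof -
  define A where "A = (\<Sum>i\<in>I. replicate_mset (k i) i)"
  have cA: "count A i = (if i \<in> I then k i else 0)" for i
    unfolding A_def by (simp add: count_sum I)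
  then have sA: "set_mset A \<subseteq> I" by (metis not_in_iff subsetI)
  have total': "2 * Lcm {1..M} \<le> sum_mset (image_mset w A)"
    using total by (simp add: sum_mset_image_eq_sum[OF I sA] cA)
  have range: "x \<in> {1..M}" if "x \<in># image_mset w A" for x
    using that w sA by auto
  obtain B where B: "B \<subseteq># image_mset w A" "sum_mset B = Lcm {1..M}"
    using submultiset_sum_eq_Lcm[OF range total'] .
  obtain C where "image_mset w A = B + C"
    using B(1) by (auto simp: mset_subset_eq_exists_conv)
  from image_mset_eq_plusD[OF this]
  obtain B' C' where "A = B' + C'" "B = image_mset w B'" by blast
  then have B': "B' \<subseteq># A" "sum_mset (image_mset w B') = Lcm {1..M}"
    using B(2) by simp_all
  show thesis
  proof (rule that[of "count B'"])
    show "count B' i \<le> k i" for i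
      using B'(1) cA[of i] mset_subset_eq_count[OF B'(1), of i] by (auto split: if_splits)
    have "set_mset B' \<subseteq> I" using B'(1) sA set_mset_mono by blast
    then show "(\<Sum>i\<in>I. w i * count B' i) = Lcm {1..M}"
      using B'(2) by (simp add: sum_mset_image_eq_sum[OF I])
  qed
qed

section \<open>The monomials of the Rees ring and their factorization\<close>

text \<open>These are exactly the exponents of the monomials in the Rees ring, as
  \<open>keys_rees_ring\<close> and \<open>single_in_rees_ring\<close> show: each factor
  \<open>x\<^sub>i\<close> can carry at most \<open>w i\<close> factors \<open>t\<close>.\<close>

definition rees_monomials :: "nat \<Rightarrow> (nat \<Rightarrow> nat) \<Rightarrow> (nat \<Rightarrow>\<^sub>0 nat) set"
  where "rees_monomials n w = {m. Poly_Mapping.keys m \<subseteq> {0..n} \<and>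
    Poly_Mapping.lookup m 0 \<le> (\<Sum>i\<in>{1..n}. w i * Poly_Mapping.lookup m i)}"

lemma rees_monomials_add:
  assumes "k \<in> rees_monomials n w" "l \<in> rees_monomials n w"
  shows "k + l \<in> rees_monomials n w"
  using assms keys_add[of k l]
  by (auto simp: rees_monomials_def lookup_add distrib_left sum.distrib)

text \<open>The set of exponents is closed under addition, so the polynomials supported on it form a
  subring; it contains the generators and therefore their hull.\<close>

lemma keys_rees_ring:
  fixes p :: "'a::comm_ring_1 mpoly"
  assumes "p \<in> rees_ring n w"
  shows "Poly_Mapping.keys p \<subseteq> rees_monomials n w"
proof -
  have zero: "0 \<in> rees_monomials n w" by (simp add: rees_monomials_def)
  let ?T = "{p :: 'a mpoly. Poly_Mapping.keys p \<subseteq> rees_monomials n w}"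
  have "rees_ring n w \<subseteq> ?T"
    unfolding rees_ring_def
  proof (rule hull_minimal)
    show "is_subring ?T"
      unfolding is_subring_def
    proof (intro conjI ballI)
      show "1 \<in> ?T" using zero by simp
      fix a b assume ab: "a \<in> ?T" "b \<in> ?T"
      show "a - b \<in> ?T" using ab mpoly_keys_diff[of a b] by blast
      show "a * b \<in> ?T" using ab keys_mult[of a b] rees_monomials_add by blast
    qed
    have "mvar 0 ^ d * mvar i \<in> ?T" if "i \<in> {1..n}" "d \<le> w i" for i d
    proof -
      let ?k = "Poly_Mapping.single 0 d + Poly_Mapping.single i 1"
      have "Poly_Mapping.keys ?k \<subseteq> {0..n}"
        using that keys_add[of "Poly_Mapping.single 0 d" "Poly_Mapping.single i 1"]
        by (auto split: if_splits)
      \<comment> \<open>The single summand at \<open>i\<close> is already at least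
        \<open>w i\<close>, which bounds the exponent \<open>d\<close> of \<open>t\<close>.\<close>
      moreover have "w i * Poly_Mapping.lookup ?k i
          \<le> (\<Sum>i\<in>{1..n}. w i * Poly_Mapping.lookup ?k i)"
        using that by (intro member_le_sum) auto
      ultimately have "?k \<in> rees_monomials n w"
        using that by (auto simp: rees_monomials_def lookup_add lookup_single when_def)
      moreover have "mvar 0 ^ d * mvar i = (Poly_Mapping.single ?k 1 :: 'a mpoly)"
        unfolding mvar_power by (simp add: mvar_def mult_single)
      ultimately show ?thesis by simp
    qed
    then show "range mconst \<union> {mvar 0 ^ d * mvar i | i d. i \<in> {1..n} \<and> d \<le> w i} \<subseteq> ?T"
      using zero by (auto simp: mconst_def split: if_splits)
  qed
  then show ?thesis using assms by blast
qed

text \<open>Induction on the total degree in the variables other than \<open>t\<close>: any such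
  variable that occurs is split off as a generator together with a power of
  \<open>t\<close>.\<close>

lemma single_in_rees_ring:
  assumes "m \<in> rees_monomials n w"
  shows "Poly_Mapping.single m (c::'a::comm_ring_1) \<in> rees_ring n w"
proof -
  let ?R = "rees_ring n w :: 'a mpoly set"
  let ?deg = "\<lambda>m::nat \<Rightarrow>\<^sub>0 nat. \<Sum>i\<in>{1..n}. Poly_Mapping.lookup m i"
  note mult = is_subring_mult[OF is_subring_rees_ring[of n w, where 'a = 'a]]
  have "Poly_Mapping.single m (1::'a) \<in> ?R"
    using assms
  proof (induction "?deg m" arbitrary: m)
    case 0
    then have z: "Poly_Mapping.lookup m i = 0" if "i \<in> {1..n}" for i
      using that by simp
    then have wz: "(\<Sum>i\<in>{1..n}. w i * Poly_Mapping.lookup m i) = 0" by (intro sum.neutral) simp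
    from "0.prems" have z0: "Poly_Mapping.lookup m 0 = 0"
      unfolding rees_monomials_def mem_Collect_eq wz by blast
    have "m = 0"
    proof (rule poly_mapping_eqI)
      fix i show "Poly_Mapping.lookup m i = Poly_Mapping.lookup 0 i"
        using "0.prems" z[of i] z0
        by (cases "i = 0"; cases "i \<le> n") (auto simp: rees_monomials_def in_keys_iff)
    qed
    then show ?case using is_subring_rees_ring[of n w, where 'a = 'a] by (auto simp: is_subring_def)
  next
    case (Suc s)
    then obtain i where i: "i \<in> {1..n}" "Poly_Mapping.lookup m i \<noteq> 0"
      by (metis nat.distinct(1) sum.neutral)
    \<comment> \<open>The split-off variable takes as much \<open>t\<close> as it can carry. Either
      no \<open>t\<close> is left, or both sides of the defining inequality drop by exactly
      \<open>w i\<close>; the quotient \<open>l\<close> stays admissible in both cases.\<close>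
    define d where "d = min (Poly_Mapping.lookup m 0) (w i)"
    define g where "g = Poly_Mapping.single (0::nat) d + Poly_Mapping.single i 1"
    define l where "l = m - g"
    have m: "m = g + l"
      using i by (intro poly_mapping_eqI)
        (auto simp: l_def g_def d_def lookup_add lookup_minus lookup_single when_def)
    have li: "Poly_Mapping.lookup m j = Poly_Mapping.lookup l j + (if j = i then 1 else 0)"
      if "j \<in> {1..n}" for j
      using that by (auto simp: m g_def lookup_add lookup_single when_def)
    have "?deg m = ?deg l + 1"
      using i by (simp add: li sum.distrib)
    then have s: "s = ?deg l" using Suc.hyps by simp
    have "(\<Sum>j\<in>{1..n}. w j * Poly_Mapping.lookup m j)
        = (\<Sum>j\<in>{1..n}. w j * Poly_Mapping.lookup l j + (if j = i then w j else 0))"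
      by (intro sum.cong) (auto simp: li)
    also have "\<dots> = (\<Sum>j\<in>{1..n}. w j * Poly_Mapping.lookup l j) + w i"
      using i by (simp add: sum.distrib)
    finally have "Poly_Mapping.lookup l 0 \<le> (\<Sum>j\<in>{1..n}. w j * Poly_Mapping.lookup l j)"
      using Suc.prems i
      by (auto simp: rees_monomials_def l_def g_def d_def lookup_minus lookup_add lookup_single when_def)
    moreover have "Poly_Mapping.keys l \<subseteq> {0..n}"
      using Suc.prems by (auto simp: rees_monomials_def l_def in_keys_iff lookup_minus subset_iff)
    ultimately have l: "l \<in> rees_monomials n w" by (simp add: rees_monomials_def)
    have "mvar 0 ^ d * mvar i \<in> ?R"
      unfolding rees_ring_def using i
      by (intro hull_inc UnI2 CollectI exI[of _ i] exI[of _ d]) (simp add: d_def)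
    also have "mvar 0 ^ d * mvar i = (Poly_Mapping.single g 1 :: 'a mpoly)"
      unfolding mvar_power by (simp add: mvar_def mult_single g_def)
    finally have "Poly_Mapping.single g (1::'a) * Poly_Mapping.single l 1 \<in> ?R"
      by (rule mult[OF _ Suc.hyps(1)[OF s l]])
    then show ?case by (simp add: m mult_single)
  qed
  moreover have "mconst c \<in> ?R"
    unfolding rees_ring_def by (rule hull_inc) auto
  ultimately have "mconst c * Poly_Mapping.single m 1 \<in> ?R" by (intro mult)
  then show ?thesis by (simp add: mconst_def mult_single)
qed

text \<open>Induction on the number of factors, starting from 1, where the monomial is its own
  factor. With at least two factors the weighted degree is at least \<open>2 * N\<close>, so a part
  of weight exactly \<open>N\<close> can be split off.\<close>

lemma rees_monomials_factor:
  assumes w: "\<forall>i\<in>{1..n}. w i > 0"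
  defines "N \<equiv> Lcm {1..Max (w ` {1..n})}"
  assumes "m \<ge> 1" "k \<in> rees_monomials n w" "Poly_Mapping.lookup k 0 = N * m"
  obtains g where "k = (\<Sum>j<m. g j)"
    "\<And>j. j < m \<Longrightarrow> g j \<in> rees_monomials n w \<and> Poly_Mapping.lookup (g j) 0 = N"
proof -
  have "\<exists>g. k = (\<Sum>j<m. g j) \<and>
    (\<forall>j<m. g j \<in> rees_monomials n w \<and> Poly_Mapping.lookup (g j) 0 = N)"
    using assms(3-)
  proof (induction m arbitrary: k rule: nat_induct_at_least)
    case base
    then show ?case by (intro exI[of _ "\<lambda>_. k"]) auto
  next
    case (Suc m)
    have "2 * N \<le> N * Suc m" using Suc.hyps by (cases m) auto
    also have "\<dots> \<le> (\<Sum>i\<in>{1..n}. w i * Poly_Mapping.lookup k i)"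
      using Suc.prems by (simp add: rees_monomials_def)
    finally obtain l where l: "\<And>i. l i \<le> Poly_Mapping.lookup k i" "(\<Sum>i\<in>{1..n}. w i * l i) = N"
      using weighted_subset_sum_eq_Lcm[of "{1..n}" w "Max (w ` {1..n})" "Poly_Mapping.lookup k"] w
      unfolding N_def by (auto simp: Suc_le_eq)
    \<comment> \<open>Both the exponent of \<open>t\<close> and the weighted degree of
      \<open>h\<close> equal \<open>N\<close>. Thus \<open>h\<close> itself is admissible, and
      removing it lowers both sides of the inequality for \<open>k\<close> by the same
      amount.\<close>
    define h where "h = Poly_Mapping.single 0 N + (\<Sum>i\<in>{1..n}. Poly_Mapping.single i (l i))"
    have h: "Poly_Mapping.lookup h i = (if i = 0 then N else if i \<in> {1..n} then l i else 0)" for i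
      by (auto simp: h_def lookup_add lookup_sum lookup_single when_def)
    have le: "Poly_Mapping.lookup h i \<le> Poly_Mapping.lookup k i" for i
      using l(1)[of i] Suc.prems(2) by (auto simp: h)
    have k: "k = (k - h) + h"
      using le by (intro poly_mapping_eqI) (simp add: lookup_add lookup_minus)
    have sh: "(\<Sum>i\<in>{1..n}. w i * Poly_Mapping.lookup h i) = N"
      unfolding l(2)[symmetric] by (rule sum.cong[OF refl], subst h) simp
    have "Poly_Mapping.keys h \<subseteq> {0..n}"
      by (auto simp: in_keys_iff h split: if_splits)
    then have hW: "h \<in> rees_monomials n w"
      using sh by (simp add: rees_monomials_def h)
    have "(\<Sum>i\<in>{1..n}. w i * Poly_Mapping.lookup k i)
        = (\<Sum>i\<in>{1..n}. w i * Poly_Mapping.lookup (k - h) i) + N"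
      unfolding sh[symmetric] sum.distrib[symmetric] distrib_left[symmetric]
      by (subst (1) k) (simp add: lookup_add)
    moreover have k0: "Poly_Mapping.lookup (k - h) 0 = N * m"
      using Suc.prems(2) by (simp add: lookup_minus h)
    moreover have "Poly_Mapping.keys (k - h) \<subseteq> {0..n}"
      using Suc.prems(1) by (auto simp: rees_monomials_def in_keys_iff lookup_minus subset_iff)
    ultimately have "k - h \<in> rees_monomials n w"
      using Suc.prems by (simp add: rees_monomials_def)
    from Suc.IH[OF this k0] obtain g where g: "k - h = (\<Sum>j<m. g j)"
      "\<forall>j<m. g j \<in> rees_monomials n w \<and> Poly_Mapping.lookup (g j) 0 = N" by blast
    show ?case
    proof (intro exI[of _ "g(m := h)"] conjI)
      show "k = (\<Sum>j<Suc m. (g(m := h)) j)" using k g(1) by simp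
      show "\<forall>j<Suc m. (g(m := h)) j \<in> rees_monomials n w
          \<and> Poly_Mapping.lookup ((g(m := h)) j) 0 = N"
        using g(2) hW by (auto simp: less_Suc_eq h)
    qed
  qed
  then show thesis using that by blast
qed

section \<open>From monomials to generation of the Veronese subring in degree 1\<close>

lemma prod_single:
  fixes g :: "nat \<Rightarrow> 'b::comm_monoid_add" and c :: "nat \<Rightarrow> 'a::comm_semiring_1"
  shows "(\<Prod>j<m. Poly_Mapping.single (g j) (c j)) = Poly_Mapping.single (\<Sum>j<m. g j) (\<Prod>j<m. c j)"
  by (induction m) (simp_all add: mult_single)

lemma sum_in_group_closure:
  "(\<And>i. i \<in> I \<Longrightarrow> f i \<in> group_closure S) \<Longrightarrow> (\<Sum>i\<in>I. f i) \<in> group_closure S"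
  by (induction I rule: infinite_finite_induct) (auto intro: group_closure_add)

lemma power_span_subset:
  assumes "graded_ring S G"
  shows "power_span (G d) m \<subseteq> G (m * d)"
proof
  fix x assume "x \<in> power_span (G d) m"
  have gc: "group_closure (G (m * d)) = G (m * d)"
    using assms by (simp add: graded_ring_def)
  have prod: "(\<Prod>j<m. f j) \<in> G (m * d)" if "\<forall>j<m. f j \<in> G d" for f
    using that
  proof (induction m)
    case (Suc m)
    then have "f m * (\<Prod>j<m. f j) \<in> G (d + m * d)"
      using assms unfolding graded_ring_def by simp
    then show ?case by (simp add: mult.commute)
  qed (use assms in \<open>simp add: graded_ring_def\<close>)
  from \<open>x \<in> power_span (G d) m\<close> have "x \<in> group_closure (G (m * d))"
    unfolding power_span_def
    by induction (use prod in \<open>auto intro: group_closure.intros\<close>)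
  then show "x \<in> G (m * d)" by (simp add: gc)
qed

theorem proposition1p17:
  fixes n N :: nat and w :: "nat \<Rightarrow> nat"
    and R :: "nat \<Rightarrow> 'a::comm_ring_1 mpoly set"
  assumes "n \<ge> 1"
    and "\<forall>i\<in>{1..n}. w i > 0"
  defines "N \<equiv> Lcm {1..Max (w ` {1..n})}"
  defines "R \<equiv> rees_component n w"
  shows "generated_in_degree_one (veronese N R) (veronese_component N R)"
proof -
  let ?V = "veronese_component N R"
  have N: "N \<ge> 1" unfolding N_def by (auto simp: Lcm_0_iff Suc_le_eq intro!: Nat.gr0I)
  have V: "graded_ring (veronese N R) ?V"
    unfolding R_def by (rule graded_ring_veronese[OF graded_ring_rees N])
  \<comment> \<open>It suffices to compare components: once they agree, the direct sum decomposition
    is that of the grading \<open>V\<close>.\<close>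
  have "power_span (?V 1) m = ?V m" if m: "m \<ge> 1" for m
  proof
    show "power_span (?V 1) m \<subseteq> ?V m" using power_span_subset[OF V, of 1 m] by simp
    show "?V m \<subseteq> power_span (?V 1) m"
    proof
      fix p assume p: "p \<in> ?V m"
      have "Poly_Mapping.single k c \<in> power_span (?V 1) m"
        if k: "k \<in> Poly_Mapping.keys p" for k c
      proof -
        have "k \<in> rees_monomials n w" "Poly_Mapping.lookup k 0 = N * m"
          using p k keys_rees_ring[of p n w]
          by (auto simp: R_def veronese_component_def rees_component_def)
        then obtain g where g: "k = (\<Sum>j<m. g j)"
          "\<And>j. j < m \<Longrightarrow> g j \<in> rees_monomials n w \<and> Poly_Mapping.lookup (g j) 0 = N"
          using rees_monomials_factor[OF assms(2) m] unfolding N_def by blast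
        \<comment> \<open>The coefficient \<open>c\<close> is placed in the factor with index 0,
          which exists because \<open>m\<close> is at least 1.\<close>
        define f where "f j = Poly_Mapping.single (g j) (if j = 0 then c else 1)" for j
        have "(\<Prod>j<m. if j = 0 then c else 1) = c" using m by (simp add: prod.delta)
        then have "Poly_Mapping.single k c = (\<Prod>j<m. f j)"
          by (simp add: f_def prod_single g(1))
        moreover have "\<forall>j<m. f j \<in> ?V 1"
          using g(2) by (auto simp: f_def R_def veronese_component_def rees_component_def
              single_in_rees_ring)
        ultimately show ?thesis
          unfolding power_span_def by (intro group_closure.base) blast
      qed
      then show "p \<in> power_span (?V 1) m"
        by (subst mpoly_eq_sum_monomials)
          (auto simp: power_span_def intro!: sum_in_group_closure)
    qed
  qed
  then have "(\<lambda>m. if m = 0 then ?V 0 else power_span (?V 1) m) = ?V"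
    by (intro ext) (simp del: One_nat_def)
  then show ?thesis
    using V by (simp only: generated_in_degree_one_def graded_ring_def)
qed

end
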